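(* Let $\mathbb{K}$ be a field of characteristic $0$ and let $V$ be a $3$-dimensional $\mathbb{K}$-vector space with basis $x_1,x_2,x_3$, endowed with the skew-symmetric bilinear bracket $[\cdot,\cdot]_0$ determined by $$[x_1,x_2]_0 = 2x_2,\qquad [x_1,x_3]_0=-2x_3,\qquad [x_2,x_3]_0=x_1,$$ so that $(V,[\cdot,\cdot]_0)\cong\mathfrak{sl}_2(\mathbb{K})$. Let $[\cdot,\cdot]_1\colon V\times V\to V$ be a bilinear skew-symmetric map and let $\alpha_1\colon V\to V$ be a linear map, and consider $$[\cdot,\cdot]_t=[\cdot,\cdot]_0+t[\cdot,\cdot]_1,\qquad \alpha_t=\alpha_0+t\alpha_1,\qquad \alpha_0=\mathrm{id}_V .$$ Assume that $([\cdot,\cdot]_t,\alpha_t)$ defines an infinitesimal Hom-Lie deformation of $(V,[\cdot,\cdot]_0)$ over $\mathbb{K}[t]/(t^2)$ and that $(V,[\cdot,\cdot]_0,\alpha_1)$ is a Hom-Lie algebra. Then the bracket $[\cdot,\cdot]_t$ satisfies the usual Jacobi identity over $\mathbb{K}[t]$ (that is, on $V\otimes_{\mathbb{K}}\mathbb{K}[t]$), and hence $(V,[\cdot,\cdot]_t)$ is a Lie algebra for every value of $t$ (that is, for every specialization of $t$ to an element of $\mathbb{K}$).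
   Context: A Hom-Lie algebra over a commutative ring $R$ (here $R=\mathbb{K}$ or $R=\mathbb{K}[t]/(t^2)$) is a triple $(M,[\cdot,\cdot],\alpha)$ consisting of an $R$-module $M$, an $R$-bilinear skew-symmetric bracket $[\cdot,\cdot]\colon M\times M\to M$ and an $R$-linear map $\alpha\colon M\to M$ satisfying the Hom-Jacobi identity $$[\alpha(x),[y,z]]+[\alpha(y),[z,x]]+[\alpha(z),[x,y]]=0\qquad\text{for all }x,y,z\in M.$$ The map $\alpha$ is not required to be compatible with the bracket. The maps $[\cdot,\cdot]_t$ and $\alpha_t$ are extended $\mathbb{K}[t]$-bilinearly, respectively $\mathbb{K}[t]$-linearly, to $V\otimes_{\mathbb{K}}\mathbb{K}[t]$, and similarly over $\mathbb{K}[t]/(t^2)$ to $V\otimes_{\mathbb{K}}\mathbb{K}[t]/(t^2)$. One says that $([\cdot,\cdot]_t,\alpha_t)$ defines an infinitesimal Hom-Lie deformation of $(V,[\cdot,\cdot]_0)$ over $\mathbb{K}[t]/(t^2)$ if $(V\otimes_{\mathbb{K}}\mathbb{K}[t]/(t^2),[\cdot,\cdot]_t,\alpha_t)$ is a Hom-Lie algebra over $\mathbb{K}[t]/(t^2)$. *)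

theory Defs
  imports "HOL-Computational_Algebra.Polynomial"
begin

section \<open>Hom-Lie algebras and Lie algebras over a commutative ring\<close>

definition bilinear_over ::
    "('r::comm_ring_1 \<Rightarrow> 'm::ab_group_add \<Rightarrow> 'm) \<Rightarrow> ('m \<Rightarrow> 'm \<Rightarrow> 'm) \<Rightarrow> bool" where
  "bilinear_over scale br \<longleftrightarrow>
     (\<forall>x. module_hom scale scale (br x)) \<and> (\<forall>y. module_hom scale scale (\<lambda>x. br x y))"

definition skew_symmetric :: "('m::ab_group_add \<Rightarrow> 'm \<Rightarrow> 'm) \<Rightarrow> bool" where
  "skew_symmetric br \<longleftrightarrow> (\<forall>x y. br x y = - br y x)"

definition hom_jacobi :: "('m::ab_group_add \<Rightarrow> 'm \<Rightarrow> 'm) \<Rightarrow> ('m \<Rightarrow> 'm) \<Rightarrow> bool" where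
  "hom_jacobi br \<alpha> \<longleftrightarrow>
     (\<forall>x y z. br (\<alpha> x) (br y z) + br (\<alpha> y) (br z x) + br (\<alpha> z) (br x y) = 0)"

definition jacobi :: "('m::ab_group_add \<Rightarrow> 'm \<Rightarrow> 'm) \<Rightarrow> bool" where
  "jacobi br \<longleftrightarrow> (\<forall>x y z. br x (br y z) + br y (br z x) + br z (br x y) = 0)"

definition hom_lie_algebra ::
    "('r::comm_ring_1 \<Rightarrow> 'm::ab_group_add \<Rightarrow> 'm) \<Rightarrow> ('m \<Rightarrow> 'm \<Rightarrow> 'm) \<Rightarrow> ('m \<Rightarrow> 'm) \<Rightarrow> bool" where
  "hom_lie_algebra scale br \<alpha> \<longleftrightarrow>
     module scale \<and> bilinear_over scale br \<and> skew_symmetric br \<and>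
     module_hom scale scale \<alpha> \<and> hom_jacobi br \<alpha>"

definition lie_algebra ::
    "('r::comm_ring_1 \<Rightarrow> 'm::ab_group_add \<Rightarrow> 'm) \<Rightarrow> ('m \<Rightarrow> 'm \<Rightarrow> 'm) \<Rightarrow> bool" where
  "lie_algebra scale br \<longleftrightarrow>
     module scale \<and> bilinear_over scale br \<and> (\<forall>x. br x x = 0) \<and> jacobi br"


section \<open>Extension of scalars to \<open>K[t]\<close>\<close>

text \<open>
  For a \<open>K\<close>-vector space on the type \<open>'v\<close>, the tensor product of \<open>V\<close> and \<open>K[t]\<close> over \<open>K\<close> is
  modelled by \<open>'v poly\<close>, the finite sums of terms \<open>t^i v\<^sub>i\<close>: \<open>monom v i\<close> is the tensor of \<open>v\<close> with
  \<open>t^i\<close>, and \<open>pCons 0\<close> is multiplication by \<open>t\<close>.  The function \<open>poly_bilin b\<close> is the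
  \<open>t\<close>-bilinear extension of \<open>b\<close>, sending \<open>(t^i v, t^j w)\<close> to \<open>t^(i+j) b v w\<close>.  Applied to the
  scalar multiplication of \<open>V\<close> it gives the action of \<open>K[t]\<close>.  Linear maps are extended by
  \<open>map_poly\<close>.
\<close>

definition poly_bilin ::
    "('a::zero \<Rightarrow> 'b::zero \<Rightarrow> 'c::comm_monoid_add) \<Rightarrow> 'a poly \<Rightarrow> 'b poly \<Rightarrow> 'c poly" where
  "poly_bilin b p q =
     (\<Sum>i\<le>degree p. \<Sum>j\<le>degree q. monom (b (coeff p i) (coeff q j)) (i + j))"

definition poly_scale ::
    "('k::comm_ring_1 \<Rightarrow> 'v::ab_group_add \<Rightarrow> 'v) \<Rightarrow> 'k poly \<Rightarrow> 'v poly \<Rightarrow> 'v poly" where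
  "poly_scale scale = poly_bilin scale"

definition deformed_bracket ::
    "('v::ab_group_add \<Rightarrow> 'v \<Rightarrow> 'v) \<Rightarrow> ('v \<Rightarrow> 'v \<Rightarrow> 'v) \<Rightarrow> 'v poly \<Rightarrow> 'v poly \<Rightarrow> 'v poly" where
  "deformed_bracket br0 br1 p q = poly_bilin br0 p q + pCons 0 (poly_bilin br1 p q)"

definition deformed_map ::
    "('v::ab_group_add \<Rightarrow> 'v) \<Rightarrow> ('v \<Rightarrow> 'v) \<Rightarrow> 'v poly \<Rightarrow> 'v poly" where
  "deformed_map \<alpha>0 \<alpha>1 p = map_poly \<alpha>0 p + pCons 0 (map_poly \<alpha>1 p)"


section \<open>Reduction modulo \<open>t^2\<close>\<close>

definition cong_t2 :: "'a::ab_group_add poly \<Rightarrow> 'a poly \<Rightarrow> bool" where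
  "cong_t2 p q \<longleftrightarrow> (\<exists>r. p - q = pCons 0 (pCons 0 r))"

lemma cong_t2_iff: "cong_t2 p q \<longleftrightarrow> coeff p 0 = coeff q 0 \<and> coeff p 1 = coeff q 1"
proof
  assume "cong_t2 p q"
  then obtain r where r: "p - q = pCons 0 (pCons 0 r)"
    by (auto simp: cong_t2_def)
  have "coeff (p - q) 0 = 0" "coeff (p - q) 1 = 0"
    unfolding r by simp_all
  then show "coeff p 0 = coeff q 0 \<and> coeff p 1 = coeff q 1"
    by simp
next
  assume *: "coeff p 0 = coeff q 0 \<and> coeff p 1 = coeff q 1"
  obtain a p' where 1: "p - q = pCons a p'" by (cases "p - q")
  obtain b r where 2: "p' = pCons b r" by (cases p')
  have "a = coeff (p - q) 0" "b = coeff (p - q) 1"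
    unfolding 1 2 by simp_all
  with * have "a = 0" "b = 0" by simp_all
  with 1 2 show "cong_t2 p q"
    by (auto simp: cong_t2_def)
qed

lemma cong_t2_iff_dvd:
  fixes p q :: "'a::comm_ring_1 poly"
  shows "cong_t2 p q \<longleftrightarrow> monom 1 2 dvd p - q"
proof -
  have "monom 1 2 * r = pCons 0 (pCons 0 r)" for r :: "'a poly"
    by (simp add: numeral_2_eq_2 monom_Suc monom_0)
  then show ?thesis
    by (auto simp: cong_t2_def dvd_def)
qed

text \<open>
  The quotient of \<open>'k poly\<close> by the ideal generated by \<open>t^2\<close> is the ring \<open>K[t]/(t^2)\<close>; the quotient
  of \<open>'v poly\<close> by its submodule \<open>t^2 V[t]\<close> is the tensor product of \<open>V\<close> and \<open>K[t]/(t^2)\<close>.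
\<close>

quotient_type (overloaded) 'a trunc = "'a::ab_group_add poly" / cong_t2
  by (rule equivpI) (auto simp: reflp_def symp_def transp_def cong_t2_iff)

instantiation trunc :: (ab_group_add) ab_group_add
begin

lift_definition zero_trunc :: "'a trunc" is 0 .
lift_definition plus_trunc :: "'a trunc \<Rightarrow> 'a trunc \<Rightarrow> 'a trunc" is "(+)"
  by (simp add: cong_t2_iff)
lift_definition minus_trunc :: "'a trunc \<Rightarrow> 'a trunc \<Rightarrow> 'a trunc" is "(-)"
  by (simp add: cong_t2_iff)
lift_definition uminus_trunc :: "'a trunc \<Rightarrow> 'a trunc" is uminus
  by (simp add: cong_t2_iff)

instance
  by standard (transfer; simp add: cong_t2_iff algebra_simps)+

end

instantiation trunc :: (comm_ring_1) comm_ring_1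
begin

lift_definition one_trunc :: "'a trunc" is 1 .
lift_definition times_trunc :: "'a trunc \<Rightarrow> 'a trunc \<Rightarrow> 'a trunc" is "(*)"
  by (simp add: cong_t2_iff coeff_mult)

instance
  by standard (transfer; simp add: cong_t2_iff algebra_simps coeff_mult)+

end

text \<open>
  Operations on polynomials are carried over by choosing representatives.  This is meaningful
  for operations that respect \<open>cong_t2\<close>; see \<open>trunc_bilin_abs\<close>, \<open>trunc_bracket_abs\<close> and
  \<open>trunc_map_abs\<close> below.
\<close>

definition trunc_scale ::
    "('k::comm_ring_1 \<Rightarrow> 'v::ab_group_add \<Rightarrow> 'v) \<Rightarrow> 'k trunc \<Rightarrow> 'v trunc \<Rightarrow> 'v trunc" where
  "trunc_scale scale a x = abs_trunc (poly_scale scale (rep_trunc a) (rep_trunc x))"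

definition trunc_bracket ::
    "('v::ab_group_add \<Rightarrow> 'v \<Rightarrow> 'v) \<Rightarrow> ('v \<Rightarrow> 'v \<Rightarrow> 'v) \<Rightarrow> 'v trunc \<Rightarrow> 'v trunc \<Rightarrow> 'v trunc" where
  "trunc_bracket br0 br1 x y = abs_trunc (deformed_bracket br0 br1 (rep_trunc x) (rep_trunc y))"

definition trunc_map ::
    "('v::ab_group_add \<Rightarrow> 'v) \<Rightarrow> ('v \<Rightarrow> 'v) \<Rightarrow> 'v trunc \<Rightarrow> 'v trunc" where
  "trunc_map \<alpha>0 \<alpha>1 x = abs_trunc (deformed_map \<alpha>0 \<alpha>1 (rep_trunc x))"

definition infinitesimal_hom_lie_deformation ::
    "('k::comm_ring_1 \<Rightarrow> 'v::ab_group_add \<Rightarrow> 'v) \<Rightarrow> ('v \<Rightarrow> 'v \<Rightarrow> 'v) \<Rightarrow> ('v \<Rightarrow> 'v \<Rightarrow> 'v) \<Rightarrow>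
     ('v \<Rightarrow> 'v) \<Rightarrow> ('v \<Rightarrow> 'v) \<Rightarrow> bool" where
  "infinitesimal_hom_lie_deformation scale br0 br1 \<alpha>0 \<alpha>1 \<longleftrightarrow>
     hom_lie_algebra (trunc_scale scale) (trunc_bracket br0 br1) (trunc_map \<alpha>0 \<alpha>1)"


section \<open>The extended operations are the expected ones\<close>

definition biadditive ::
    "('a::ab_group_add \<Rightarrow> 'b::ab_group_add \<Rightarrow> 'c::ab_group_add) \<Rightarrow> bool" where
  "biadditive b \<longleftrightarrow> (\<forall>x. additive (b x)) \<and> (\<forall>y. additive (\<lambda>x. b x y))"

lemma biadditiveD:
  assumes "biadditive b"
  shows "b (x + x') y = b x y + b x' y" "b x (y + y') = b x y + b x y'"
    "b 0 y = 0" "b x 0 = 0" "b (- x) y = - b x y" "b x (- y) = - b x y"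
    "b (x - x') y = b x y - b x' y" "b x (y - y') = b x y - b x y'"
    "b (sum f A) y = (\<Sum>i\<in>A. b (f i) y)" "b x (sum g B) = (\<Sum>i\<in>B. b x (g i))"
proof -
  interpret l: additive "\<lambda>x. b x y" using assms by (simp add: biadditive_def)
  interpret r: additive "b x" using assms by (simp add: biadditive_def)
  show "b (x + x') y = b x y + b x' y" "b x (y + y') = b x y + b x y'"
    "b 0 y = 0" "b x 0 = 0" "b (- x) y = - b x y" "b x (- y) = - b x y"
    "b (x - x') y = b x y - b x' y" "b x (y - y') = b x y - b x y'"
    "b (sum f A) y = (\<Sum>i\<in>A. b (f i) y)" "b x (sum g B) = (\<Sum>i\<in>B. b x (g i))"
    by (fact l.add r.add l.zero r.zero l.minus r.minus l.diff r.diff l.sum r.sum)+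
qed

lemma module_biadditive: "module scale \<Longrightarrow> biadditive scale"
  by (auto simp: biadditive_def additive_def module_def)

lemma bilinear_overD:
  assumes "bilinear_over scale br"
  shows "br (x + x') y = br x y + br x' y" "br x (y + y') = br x y + br x y'"
    "br (scale c x) y = scale c (br x y)" "br x (scale c y) = scale c (br x y)"
proof -
  interpret l: module_hom scale scale "\<lambda>x. br x y" using assms by (simp add: bilinear_over_def)
  interpret r: module_hom scale scale "br x" using assms by (simp add: bilinear_over_def)
  show "br (x + x') y = br x y + br x' y" "br x (y + y') = br x y + br x y'"
    "br (scale c x) y = scale c (br x y)" "br x (scale c y) = scale c (br x y)"
    by (fact l.add r.add l.scale r.scale)+
qed

lemma bilinear_over_biadditive: "bilinear_over scale br \<Longrightarrow> biadditive br"
  by (simp add: biadditive_def additive_def bilinear_overD(1,2)[of scale br])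

lemma coeff_poly_bilin:
  assumes "biadditive b"
  shows "coeff (poly_bilin b p q) n = (\<Sum>i\<le>n. b (coeff p i) (coeff q (n - i)))"
proof -
  note [simp] = biadditiveD[OF assms]
  have inner: "(\<Sum>j\<le>degree q. if i + j = n then b (coeff p i) (coeff q j) else 0)
      = (if i \<le> n then b (coeff p i) (coeff q (n - i)) else 0)" for i
  proof (cases "i \<le> n")
    case True
    then have "(i + j = n) = (j = n - i)" for j by auto
    then show ?thesis
      using True by (simp add: sum.delta coeff_eq_0 not_le)
  qed auto
  have "coeff (poly_bilin b p q) n
      = (\<Sum>i\<le>degree p. if i \<le> n then b (coeff p i) (coeff q (n - i)) else 0)"
    by (simp add: poly_bilin_def coeff_sum inner)
  also have "\<dots> = (\<Sum>i\<in>{..degree p} \<inter> {..n}. b (coeff p i) (coeff q (n - i)))"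
    by (subst sum.inter_restrict) (auto intro: sum.cong)
  also have "\<dots> = (\<Sum>i\<le>n. b (coeff p i) (coeff q (n - i)))"
  proof (rule sum.mono_neutral_left)
    show "\<forall>i\<in>{..n} - {..degree p} \<inter> {..n}. b (coeff p i) (coeff q (n - i)) = 0"
    proof
      fix i
      assume "i \<in> {..n} - {..degree p} \<inter> {..n}"
      then have "degree p < i" by auto
      then show "b (coeff p i) (coeff q (n - i)) = 0" by (simp add: coeff_eq_0)
    qed
  qed auto
  finally show ?thesis .
qed

lemma poly_bilin_monom:
  assumes "biadditive b"
  shows "poly_bilin b (monom v i) (monom w j) = monom (b v w) (i + j)"
proof (rule poly_eqI)
  fix n
  have "coeff (poly_bilin b (monom v i) (monom w j)) n
      = (\<Sum>k\<le>n. if k = i then b v (coeff (monom w j) (n - i)) else 0)"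
    unfolding coeff_poly_bilin[OF assms]
    by (rule sum.cong) (auto simp: biadditiveD[OF assms])
  then show "coeff (poly_bilin b (monom v i) (monom w j)) n = coeff (monom (b v w) (i + j)) n"
    by (auto simp: biadditiveD[OF assms])
qed

lemma poly_bilin_times: "poly_bilin (*) p q = p * (q :: 'a::comm_ring_1 poly)"
  by (rule poly_eqI)
    (simp add: coeff_poly_bilin coeff_mult biadditive_def additive_def algebra_simps)

lemma poly_bilin_biadditive: "biadditive b \<Longrightarrow> biadditive (poly_bilin b)"
  unfolding biadditive_def[of "poly_bilin b"] additive_def
  by (intro conjI allI poly_eqI)
    (simp_all add: coeff_poly_bilin biadditiveD(1,2)[of b] sum.distrib)

lemma biadditive_flip: "biadditive b \<Longrightarrow> biadditive (\<lambda>x y. b y x)"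
  by (simp add: biadditive_def)

lemma poly_bilin_flip: "poly_bilin b p q = poly_bilin (\<lambda>x y. b y x) q p"
  unfolding poly_bilin_def by (subst sum.swap) (simp add: add.commute)

lemma poly_bilin_pCons:
  assumes "biadditive b"
  shows "poly_bilin b (pCons a p) q = map_poly (b a) q + pCons 0 (poly_bilin b p q)"
proof (rule poly_eqI)
  fix n
  show "coeff (poly_bilin b (pCons a p) q) n
      = coeff (map_poly (b a) q + pCons 0 (poly_bilin b p q)) n"
    by (cases n) (simp_all add: coeff_poly_bilin[OF assms] coeff_map_poly biadditiveD[OF assms]
        sum.atMost_Suc_shift del: sum.atMost_Suc)
qed

lemma poly_bilin_assoc:
  assumes b: "biadditive f" "biadditive g" "biadditive h" "biadditive k"
    and assoc: "\<And>x y z. f (g x y) z = h x (k y z)"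
  shows "poly_bilin f (poly_bilin g p q) r = poly_bilin h p (poly_bilin k q r)"
proof (induction p)
  case 0
  show ?case
    by (simp add: biadditiveD(3)[OF poly_bilin_biadditive[OF b(1)]]
        biadditiveD(3)[OF poly_bilin_biadditive[OF b(2)]]
        biadditiveD(3)[OF poly_bilin_biadditive[OF b(3)]])
next
  case (pCons a p)
  have "poly_bilin f (map_poly (g a) q) r = map_poly (h a) (poly_bilin k q r)"
    by (rule poly_eqI)
      (simp add: coeff_map_poly coeff_poly_bilin b biadditiveD[OF b(2)] biadditiveD[OF b(3)] assoc)
  moreover have "poly_bilin f (pCons 0 u) r = pCons 0 (poly_bilin f u r)" for u
  proof -
    have "map_poly (f 0) r = 0"
      by (rule poly_eqI) (simp add: coeff_map_poly biadditiveD[OF b(1)])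
    then show ?thesis by (simp add: poly_bilin_pCons[OF b(1)])
  qed
  ultimately show ?case
    by (simp add: poly_bilin_pCons b biadditiveD[OF poly_bilin_biadditive[OF b(1)]] pCons.IH)
qed

lemma module_poly_scale:
  assumes "module scale"
  shows "module (poly_scale scale)"
proof -
  interpret module scale by fact
  note bi = module_biadditive[OF assms]
  have bt: "biadditive ((*) :: 'a \<Rightarrow> 'a \<Rightarrow> 'a)"
    by (simp add: biadditive_def additive_def algebra_simps)
  have "poly_scale scale p (poly_scale scale q x) = poly_scale scale (p * q) x" for p q x
    unfolding poly_scale_def poly_bilin_times[symmetric]
    by (rule poly_bilin_assoc[symmetric]) (simp_all add: bi bt)
  moreover have "poly_scale scale 1 x = x" for x
    unfolding poly_scale_def one_pCons poly_bilin_pCons[OF bi]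
    by (rule poly_eqI) (simp add: coeff_map_poly biadditiveD[OF poly_bilin_biadditive[OF bi]])
  ultimately show ?thesis
    by (intro module.intro)
      (simp_all add: poly_scale_def biadditiveD[OF poly_bilin_biadditive[OF bi]])
qed

lemma bilinear_over_poly_bilin:
  assumes br: "bilinear_over scale br"
  shows "bilinear_over (poly_scale scale) (poly_bilin br)"
proof -
  have m: "module scale"
    using br by (auto simp: bilinear_over_def module_hom_def)
  note bi = module_biadditive[OF m] and bb = bilinear_over_biadditive[OF br]
  note l = bilinear_overD(3)[OF br] and r = bilinear_overD(4)[OF br]
  have L: "poly_bilin br (poly_bilin scale c p) q = poly_bilin scale c (poly_bilin br p q)" for c p q
    by (rule poly_bilin_assoc) (simp_all add: bi bb l)
  have R: "poly_bilin br p (poly_bilin scale c q) = poly_bilin scale c (poly_bilin br p q)" for c p q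
    unfolding poly_bilin_flip[of br]
    by (rule poly_bilin_assoc) (simp_all add: bi bb biadditive_flip r)
  show ?thesis
    unfolding bilinear_over_def module_hom_def module_hom_axioms_def
    using module_poly_scale[OF m]
    by (simp add: poly_scale_def L R biadditiveD[OF poly_bilin_biadditive[OF bb]])
qed

lemma bilinear_over_deformed_bracket:
  assumes "bilinear_over scale br0" "bilinear_over scale br1"
  shows "bilinear_over (poly_scale scale) (deformed_bracket br0 br1)"
proof -
  have m: "module scale"
    using assms by (auto simp: bilinear_over_def module_hom_def)
  interpret P: module "poly_scale scale" by (rule module_poly_scale[OF m])
  have t: "pCons 0 p = poly_scale scale (monom 1 1) p" for p
  proof -
    have "map_poly (scale 0) p = 0" "map_poly (scale 1) p = p"
      by (auto intro!: poly_eqI simp: coeff_map_poly module.scale_zero_left[OF m]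
          module.scale_zero_right[OF m] module.scale_one[OF m])
    then show ?thesis
      by (simp add: poly_scale_def monom_Suc monom_0 poly_bilin_pCons[OF module_biadditive[OF m]]
          biadditiveD[OF poly_bilin_biadditive[OF module_biadditive[OF m]]])
  qed
  show ?thesis
    using bilinear_over_poly_bilin[OF assms(1)] bilinear_over_poly_bilin[OF assms(2)]
    by (auto simp: bilinear_over_def module_hom_def module_hom_axioms_def deformed_bracket_def t
        algebra_simps)
qed

lemma trunc_bilin_abs:
  assumes "biadditive b"
  shows "abs_trunc (poly_bilin b (rep_trunc (abs_trunc p)) (rep_trunc (abs_trunc q)))
    = abs_trunc (poly_bilin b p q)"
proof -
  have "cong_t2 (rep_trunc (abs_trunc p)) p" "cong_t2 (rep_trunc (abs_trunc q)) q"
    using Quotient_trunc by (meson Quotient_rep_abs equivp_reflp trunc_equivp)+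
  then show ?thesis
    by (auto simp: trunc.abs_eq_iff cong_t2_iff coeff_poly_bilin[OF assms])
qed

lemma trunc_scale_abs:
  "module scale \<Longrightarrow>
    trunc_scale scale (abs_trunc a) (abs_trunc p) = abs_trunc (poly_scale scale a p)"
  by (simp add: trunc_scale_def poly_scale_def trunc_bilin_abs module_biadditive)

lemma trunc_bracket_abs:
  assumes "biadditive br0" "biadditive br1"
  shows "trunc_bracket br0 br1 (abs_trunc p) (abs_trunc q) = abs_trunc (deformed_bracket br0 br1 p q)"
proof -
  have "cong_t2 (rep_trunc (abs_trunc p)) p" "cong_t2 (rep_trunc (abs_trunc q)) q"
    using Quotient_trunc by (meson Quotient_rep_abs equivp_reflp trunc_equivp)+
  then show ?thesis
    by (auto simp: trunc_bracket_def deformed_bracket_def trunc.abs_eq_iff cong_t2_iff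
        coeff_poly_bilin[OF assms(1)] coeff_poly_bilin[OF assms(2)])
qed

lemma trunc_map_abs:
  assumes "additive \<alpha>0" "additive \<alpha>1"
  shows "trunc_map \<alpha>0 \<alpha>1 (abs_trunc p) = abs_trunc (deformed_map \<alpha>0 \<alpha>1 p)"
proof -
  have "cong_t2 (rep_trunc (abs_trunc p)) p"
    using Quotient_trunc by (meson Quotient_rep_abs equivp_reflp trunc_equivp)
  then show ?thesis
    by (auto simp: trunc_map_def deformed_map_def trunc.abs_eq_iff cong_t2_iff
        coeff_map_poly additive.zero[OF assms(1)] additive.zero[OF assms(2)])
qed

lemma module_trunc_scale:
  assumes "module scale"
  shows "module (trunc_scale scale)"
proof -
  interpret P: module "poly_scale scale" by (rule module_poly_scale[OF assms])
  have abs: "\<exists>p. x = abs_trunc p" for x :: "'c::ab_group_add trunc"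
    by (metis Quotient_abs_rep Quotient_trunc)
  show ?thesis
  proof
    fix a b :: "'a trunc" and x y :: "'b trunc"
    obtain p q u v where [simp]: "a = abs_trunc p" "b = abs_trunc q" "x = abs_trunc u" "y = abs_trunc v"
      using abs by metis
    note s = trunc_scale_abs[OF assms] plus_trunc.abs_eq times_trunc.abs_eq
    show "trunc_scale scale a (x + y) = trunc_scale scale a x + trunc_scale scale a y"
      by (simp add: s P.scale_right_distrib)
    show "trunc_scale scale (a + b) x = trunc_scale scale a x + trunc_scale scale b x"
      by (simp add: s P.scale_left_distrib)
    show "trunc_scale scale a (trunc_scale scale b x) = trunc_scale scale (a * b) x"
      by (simp add: s)
    show "trunc_scale scale 1 x = x"
      by (simp add: s one_trunc.abs_eq)
  qed
qed

end

theory Submission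
  imports Defs
begin

text \<open>
  The bracket of \<open>sl\<^sub>2\<close> is nondegenerate as a map from the second exterior power of \<open>V\<close>, which
  has the same dimension as \<open>V\<close>, so \<open>[x, y]\<^sub>1 = M [x, y]\<^sub>0\<close> for a linear map \<open>M\<close>.
  Write \<open>J(a, b)\<close> for the cyclic sum of \<open>a(x, b(y, z))\<close>.  The deformation equation in degree \<open>0\<close>
  is \<open>J([]\<^sub>0, []\<^sub>0) = 0\<close>; applying \<open>M\<close> gives \<open>J([]\<^sub>1, []\<^sub>0) = 0\<close>.  In degree \<open>1\<close> the term in
  \<open>\<alpha>\<^sub>1\<close> vanishes because \<open>\<alpha>\<^sub>1\<close> is a Hom-Lie twist of \<open>[]\<^sub>0\<close>, which leaves \<open>J([]\<^sub>0, []\<^sub>1) = 0\<close>;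
  applying \<open>M\<close> again gives \<open>J([]\<^sub>1, []\<^sub>1) = 0\<close>.
\<close>

text \<open>This is J(f, g) = 0. Keeping two brackets apart gives access to the mixed terms in the
  expansion of the deformed Jacobi sum; for f = g it is the Jacobi identity.\<close>

definition cyclic_zero :: "('m::ab_group_add \<Rightarrow> 'm \<Rightarrow> 'm) \<Rightarrow> ('m \<Rightarrow> 'm \<Rightarrow> 'm) \<Rightarrow> bool" where
  "cyclic_zero f g \<longleftrightarrow> (\<forall>x y z. f x (g y z) + f y (g z x) + f z (g x y) = 0)"

lemma cyclic_zeroD: "cyclic_zero f g \<Longrightarrow> f x (g y z) + f y (g z x) + f z (g x y) = 0"
  by (simp add: cyclic_zero_def)

text \<open>Only the outer bracket is composed with \<open>M\<close>, so the new cyclic sum is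
  \<open>M\<close> applied to the old one.\<close>

lemma cyclic_zero_comp:
  assumes "additive M" "cyclic_zero f g"
  shows "cyclic_zero (\<lambda>x y. M (f x y)) g"
  unfolding cyclic_zero_def
  by (simp flip: additive.add[OF assms(1)] add: cyclic_zeroD[OF assms(2)] additive.zero[OF assms(1)])

lemma additive_poly_eq_0:
  fixes F :: "'a::ab_group_add poly \<Rightarrow> 'b::ab_group_add"
  assumes "additive F" "\<And>a n. F (monom a n) = 0"
  shows "F p = 0"
proof -
  have "F (\<Sum>i\<le>degree p. monom (coeff p i) i) = 0"
    by (simp add: additive.sum[OF assms(1)] assms(2))
  then show ?thesis
    by (simp add: poly_as_sum_of_monoms)
qed

text \<open>The cyclic sum is additive in each argument, so monomials suffice; there it is the
  cyclic sum of the coefficients, placed in the total degree.\<close>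

lemma cyclic_zero_poly_bilin:
  assumes f: "biadditive f" and g: "biadditive g" and cyc: "cyclic_zero f g"
  shows "cyclic_zero (poly_bilin f) (poly_bilin g)"
proof -
  note [simp] = biadditiveD(1,2)[OF poly_bilin_biadditive[OF f]]
    biadditiveD(1,2)[OF poly_bilin_biadditive[OF g]]
    poly_bilin_monom[OF f] poly_bilin_monom[OF g]
  define F where "F p q r = poly_bilin f p (poly_bilin g q r)
      + poly_bilin f q (poly_bilin g r p) + poly_bilin f r (poly_bilin g p q)" for p q r
  have add: "additive (\<lambda>p. F p q r)" "additive (\<lambda>q. F p q r)" "additive (\<lambda>r. F p q r)" for p q r
    by (simp_all add: F_def additive_def algebra_simps)
  have 1: "F (monom a i) (monom b j) (monom c k) = 0" for a b c i j k
  proof -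
    have "F (monom a i) (monom b j) (monom c k)
        = monom (f a (g b c) + f b (g c a) + f c (g a b)) (i + j + k)"
      by (simp add: F_def add_monom add_ac)
    then show ?thesis
      by (simp add: cyclic_zeroD[OF cyc])
  qed
  have 2: "F (monom a i) (monom b j) r = 0" for a b i j r
    by (rule additive_poly_eq_0[OF add(3) 1])
  have 3: "F (monom a i) q r = 0" for a i q r
    by (rule additive_poly_eq_0[OF add(2) 2])
  have "F p q r = 0" for p q r
    by (rule additive_poly_eq_0[OF add(1) 3])
  then show ?thesis
    by (simp add: cyclic_zero_def F_def)
qed

lemma poly_bilin_pCons_0_right:
  assumes "biadditive b"
  shows "poly_bilin b p (pCons 0 q) = pCons 0 (poly_bilin b p q)"
proof -
  have "map_poly (\<lambda>x. b x 0) p = 0"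
    by (rule poly_eqI) (simp add: coeff_map_poly biadditiveD[OF assms])
  then show ?thesis
    unfolding poly_bilin_flip[of b] by (simp add: poly_bilin_pCons biadditive_flip assms)
qed

text \<open>The Jacobi sum expands to J(0,0) + t (J(0,1) + J(1,0)) + t^2 J(1,1), where J(i,j) is the
  cyclic sum for the extensions of \<open>br\<close>i and \<open>br\<close>j.\<close>

lemma jacobi_deformed_bracket:
  fixes br0 br1 :: "'v::ab_group_add \<Rightarrow> 'v \<Rightarrow> 'v"
  assumes b: "biadditive br0" "biadditive br1"
    and cyc: "cyclic_zero br0 br0" "cyclic_zero br0 br1" "cyclic_zero br1 br0" "cyclic_zero br1 br1"
  shows "jacobi (deformed_bracket br0 br1)"
  unfolding jacobi_def
proof (intro allI)
  fix p q r :: "'v poly"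
  let ?B0 = "poly_bilin br0" and ?B1 = "poly_bilin br1"
  let ?D = "deformed_bracket br0 br1"
  let ?C = "\<lambda>f g :: 'v poly \<Rightarrow> 'v poly \<Rightarrow> 'v poly. f p (g q r) + f q (g r p) + f r (g p q)"
  \<comment> \<open>Distributes t over sums. The simp rule \<open>add_pCons\<close> works in the
    opposite direction and is therefore removed below.\<close>
  have t: "pCons 0 (u + v) = pCons 0 u + pCons 0 v" for u v :: "'v poly"
    by simp
  have "?D u (?D v w) = ?B0 u (?B0 v w)
      + pCons 0 (?B0 u (?B1 v w) + ?B1 u (?B0 v w) + pCons 0 (?B1 u (?B1 v w)))" for u v w
    by (simp add: deformed_bracket_def biadditiveD(2)[OF poly_bilin_biadditive] b
        poly_bilin_pCons_0_right t add_ac del: add_pCons)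
  then have "?C ?D ?D
      = ?C ?B0 ?B0 + pCons 0 (?C ?B0 ?B1 + ?C ?B1 ?B0 + pCons 0 (?C ?B1 ?B1))"
    by (simp add: t add_ac del: add_pCons)
  also have "\<dots> = 0"
    using b cyc by (simp add: cyclic_zeroD cyclic_zero_poly_bilin)
  finally show "?C ?D ?D = 0" .
qed

text \<open>Skew symmetry gives 2 [x, x] = 0, and 2 is invertible in characteristic 0. This supplies
  the alternation that \<open>lie_algebra\<close> demands.\<close>

lemma skew_symmetric_imp_alternating:
  fixes scale :: "'k::field_char_0 \<Rightarrow> 'v::ab_group_add \<Rightarrow> 'v"
    and br :: "'v \<Rightarrow> 'v \<Rightarrow> 'v"
  assumes "module scale" "skew_symmetric br"
  shows "br x x = 0"
proof -
  interpret vector_space scale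
    using assms(1) by (simp add: module_iff_vector_space)
  have "br x x = - br x x"
    using assms(2) unfolding skew_symmetric_def by blast
  then have "scale (1 + 1) (br x x) = 0"
    unfolding scale_left_distrib by (simp add: eq_neg_iff_add_eq_0)
  then show ?thesis
    by simp
qed

lemma bilinear_over_add_scale:
  assumes "bilinear_over scale br0" "bilinear_over scale br1"
  shows "bilinear_over scale (\<lambda>x y. br0 x y + scale c (br1 x y))"
proof -
  have "module scale"
    using assms(1) by (auto simp: bilinear_over_def module_hom_def)
  then interpret module scale .
  show ?thesis
    unfolding bilinear_over_def module_hom_def module_hom_axioms_def
    by (simp add: \<open>module scale\<close> bilinear_overD[OF assms(1)] bilinear_overD[OF assms(2)]
        scale_right_distrib mult.commute add_ac)
qed

text \<open>The expansion of the deformed Jacobi sum is repeated in V itself, with the scalar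
  \<open>c\<close> in place of t.\<close>

lemma lie_algebra_add_scale:
  fixes scale :: "'k::field_char_0 \<Rightarrow> 'v::ab_group_add \<Rightarrow> 'v"
  assumes b: "bilinear_over scale br0" "bilinear_over scale br1"
    and skew: "skew_symmetric br0" "skew_symmetric br1"
    and cyc: "cyclic_zero br0 br0" "cyclic_zero br0 br1" "cyclic_zero br1 br0" "cyclic_zero br1 br1"
  shows "lie_algebra scale (\<lambda>x y. br0 x y + scale c (br1 x y))"
proof -
  have m: "module scale"
    using b(1) by (auto simp: bilinear_over_def module_hom_def)
  then interpret module scale .
  let ?b = "\<lambda>x y. br0 x y + scale c (br1 x y)"
  have "jacobi ?b"
    unfolding jacobi_def
  proof (intro allI)
    fix x y z :: 'v
    let ?C = "\<lambda>f g :: 'v \<Rightarrow> 'v \<Rightarrow> 'v. f x (g y z) + f y (g z x) + f z (g x y)"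
    have "?C ?b ?b = ?C br0 br0 + scale c (?C br0 br1 + ?C br1 br0) + scale (c * c) (?C br1 br1)"
      by (simp add: bilinear_overD[OF b(1)] bilinear_overD[OF b(2)] scale_right_distrib add_ac)
    also have "\<dots> = 0"
      by (simp add: cyclic_zeroD[OF cyc(1)] cyclic_zeroD[OF cyc(2)] cyclic_zeroD[OF cyc(3)]
          cyclic_zeroD[OF cyc(4)])
    finally show "?C ?b ?b = 0" .
  qed
  then show ?thesis
    using m bilinear_over_add_scale[OF b]
    by (simp add: lie_algebra_def skew_symmetric_imp_alternating[OF m skew(1)]
        skew_symmetric_imp_alternating[OF m skew(2)])
qed

text \<open>The Hom-Jacobi identity is evaluated at constant polynomials; congruence modulo t^2 then
  compares exactly the coefficients of degree 0 and 1.\<close>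

lemma infinitesimal_deformation_equations:
  fixes br0 br1 :: "'v::ab_group_add \<Rightarrow> 'v \<Rightarrow> 'v"
  assumes br0: "biadditive br0" and br1: "biadditive br1" and \<alpha>1: "additive \<alpha>1"
    and deformation: "infinitesimal_hom_lie_deformation scale br0 br1 id \<alpha>1"
  shows "br0 x (br0 y z) + br0 y (br0 z x) + br0 z (br0 x y) = 0"
    and "(br0 x (br1 y z) + br0 y (br1 z x) + br0 z (br1 x y))
      + (br1 x (br0 y z) + br1 y (br0 z x) + br1 z (br0 x y))
      + (br0 (\<alpha>1 x) (br0 y z) + br0 (\<alpha>1 y) (br0 z x) + br0 (\<alpha>1 z) (br0 x y)) = 0"
proof -
  have id: "additive (id :: 'v \<Rightarrow> 'v)"
    by (simp add: additive_def)
  have "hom_jacobi (trunc_bracket br0 br1) (trunc_map id \<alpha>1)"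
    using deformation by (simp add: infinitesimal_hom_lie_deformation_def hom_lie_algebra_def)
  note jac = this[unfolded hom_jacobi_def, rule_format,
      of "abs_trunc [:x:]" "abs_trunc [:y:]" "abs_trunc [:z:]",
      unfolded trunc_map_abs[OF id \<alpha>1] trunc_bracket_abs[OF br0 br1] plus_trunc.abs_eq
        zero_trunc.abs_eq trunc.abs_eq_iff cong_t2_iff]
  note simps = deformed_bracket_def deformed_map_def coeff_poly_bilin[OF br0]
    coeff_poly_bilin[OF br1] biadditiveD[OF br0] biadditiveD[OF br1] coeff_map_poly
    additive.zero[OF \<alpha>1]
  show "br0 x (br0 y z) + br0 y (br0 z x) + br0 z (br0 x y) = 0"
    using conjunct1[OF jac] by (simp add: simps)
  show "(br0 x (br1 y z) + br0 y (br1 z x) + br0 z (br1 x y))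
      + (br1 x (br0 y z) + br1 y (br0 z x) + br1 z (br0 x y))
      + (br0 (\<alpha>1 x) (br0 y z) + br0 (\<alpha>1 y) (br0 z x) + br0 (\<alpha>1 z) (br0 x y)) = 0"
    using conjunct2[OF jac] by (simp add: simps add_ac)
qed

lemma (in module) bilinear_over_eq_on_span:
  assumes "bilinear_over scale f" "bilinear_over scale g" "span B = UNIV"
    and "\<And>x y. x \<in> B \<Longrightarrow> y \<in> B \<Longrightarrow> f x y = g x y"
  shows "f x y = g x y"
proof -
  interpret P: module_pair scale scale ..
  \<comment> \<open>Extend in the second argument first, with the first one still in
    \<open>B\<close>.\<close>
  have *: "f u y = g u y" if "u \<in> B" for u y
    by (rule P.module_hom_eq_on_span[of "f u" "g u" B])
      (use assms that in \<open>auto simp: bilinear_over_def\<close>)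
  show ?thesis
    by (rule P.module_hom_eq_on_span[of "\<lambda>x. f x y" "\<lambda>x. g x y" B])
      (use assms * in \<open>auto simp: bilinear_over_def\<close>)
qed

text \<open>The brackets of the three pairs of basis vectors are nonzero multiples of three distinct
  basis vectors, so they form a basis on which \<open>M\<close> may be prescribed.\<close>

lemma sl2_bracket_factor:
  fixes scale :: "'k::field_char_0 \<Rightarrow> 'v::ab_group_add \<Rightarrow> 'v"
  assumes basis: "finite_dimensional_vector_space scale {x1, x2, x3}" "card {x1, x2, x3} = 3"
    and br0: "bilinear_over scale br0" "skew_symmetric br0"
    and sl2: "br0 x1 x2 = scale 2 x2" "br0 x1 x3 = scale (- 2) x3" "br0 x2 x3 = x1"
    and br1: "bilinear_over scale br1" "skew_symmetric br1"
  obtains M where "module_hom scale scale M" "\<And>x y. br1 x y = M (br0 x y)"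
proof -
  interpret finite_dimensional_vector_space scale "{x1, x2, x3}" by (rule basis(1))
  interpret P: vector_space_pair scale scale ..
  have dist: "x1 \<noteq> x2" "x1 \<noteq> x3" "x2 \<noteq> x3"
    using basis(2) by (auto simp: card_insert_if split: if_splits)
  \<comment> \<open>These values are forced: \<open>M\<close> must send 2 \<open>x2\<close>, -2
    \<open>x3\<close> and \<open>x1\<close> to the corresponding values of \<open>br1\<close>. The
    case distinction relies on \<open>dist\<close>.\<close>
  define m where "m x = (if x = x1 then br1 x2 x3 else if x = x2 then scale (1 / 2) (br1 x1 x2)
      else scale (- 1 / 2) (br1 x1 x3))" for x
  obtain M where M: "Vector_Spaces.linear scale scale M" "\<And>x. x \<in> {x1, x2, x3} \<Longrightarrow> M x = m x"
    using P.linear_independent_extend[OF independent_Basis, of m] by blast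
  interpret M: Vector_Spaces.linear scale scale M by (rule M(1))
  have Mx: "M x1 = br1 x2 x3" "M x2 = scale (1 / 2) (br1 x1 x2)" "M x3 = scale (- 1 / 2) (br1 x1 x3)"
    using M(2) dist by (auto simp: m_def)
  have hom: "module_hom scale scale M"
    by unfold_locales
  have "bilinear_over scale (\<lambda>x y. M (br0 x y))"
    using br0(1) hom unfolding bilinear_over_def
    by (auto simp: module_hom_def module_hom_axioms_def)
  moreover have "br1 u v = M (br0 u v)" if "u \<in> {x1, x2, x3}" "v \<in> {x1, x2, x3}" for u v
  proof -
    \<comment> \<open>The nine pairs of basis vectors are three increasing ones, their transposes
      and the diagonal.\<close>
    have up: "br1 x1 x2 = M (br0 x1 x2)" "br1 x1 x3 = M (br0 x1 x3)" "br1 x2 x3 = M (br0 x2 x3)"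
      by (simp_all add: sl2 M.scale M.neg Mx)
    have swap: "br1 v u = M (br0 v u)" if "br1 u v = M (br0 u v)" for u v
    proof -
      have "br1 v u = - br1 u v" "br0 v u = - br0 u v"
        using br0(2) br1(2) unfolding skew_symmetric_def by blast+
      then show ?thesis using that by (simp add: M.neg)
    qed
    have diag: "br1 u u = M (br0 u u)" for u
      by (simp add: M.zero skew_symmetric_imp_alternating[OF module_axioms] br0(2) br1(2))
    show ?thesis
      using that up swap diag by auto
  qed
  ultimately have "br1 x y = M (br0 x y)" for x y
    using bilinear_over_eq_on_span[OF br1(1), of "\<lambda>x y. M (br0 x y)"] span_Basis by blast
  with hom show thesis
    by (rule that)
qed

theorem theorem1p1:
  fixes scale :: "'k::field_char_0 \<Rightarrow> 'v::ab_group_add \<Rightarrow> 'v"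
    and br0 br1 :: "'v \<Rightarrow> 'v \<Rightarrow> 'v" and \<alpha>1 :: "'v \<Rightarrow> 'v" and x1 x2 x3 :: 'v
  assumes basis: "finite_dimensional_vector_space scale {x1, x2, x3}" "card {x1, x2, x3} = 3"
    and br0: "bilinear_over scale br0" "skew_symmetric br0"
    and sl2: "br0 x1 x2 = scale 2 x2" "br0 x1 x3 = scale (- 2) x3" "br0 x2 x3 = x1"
    and br1: "bilinear_over scale br1" "skew_symmetric br1"
    and \<alpha>1: "Vector_Spaces.linear scale scale \<alpha>1"
    and deformation: "infinitesimal_hom_lie_deformation scale br0 br1 id \<alpha>1"
    and hom_lie: "hom_lie_algebra scale br0 \<alpha>1"
  shows "jacobi (deformed_bracket br0 br1) \<and>
    (\<forall>c. lie_algebra scale (\<lambda>x y. br0 x y + scale c (br1 x y)))"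
proof -
  obtain M where M: "module_hom scale scale M" and "\<And>x y. br1 x y = M (br0 x y)"
    using sl2_bracket_factor[OF basis br0 sl2 br1] by blast
  then have br1_eq: "br1 = (\<lambda>x y. M (br0 x y))"
    by blast
  have addM: "additive M" and add\<alpha>: "additive \<alpha>1"
    using module_hom.add[OF M] module_hom.add[OF \<alpha>1[folded module_hom_iff_linear]]
    by (simp_all add: additive_def)
  note b = bilinear_over_biadditive[OF br0(1)] bilinear_over_biadditive[OF br1(1)]
  note eqs = infinitesimal_deformation_equations[OF b add\<alpha> deformation]
  have c00: "cyclic_zero br0 br0"
    using eqs(1) by (simp add: cyclic_zero_def)
  have c10: "cyclic_zero br1 br0"
    unfolding br1_eq by (rule cyclic_zero_comp[OF addM c00])
  have twist: "br0 (\<alpha>1 x) (br0 y z) + br0 (\<alpha>1 y) (br0 z x) + br0 (\<alpha>1 z) (br0 x y) = 0" for x y z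
    using hom_lie by (simp add: hom_lie_algebra_def hom_jacobi_def)
  \<comment> \<open>Of the three cyclic sums in degree 1, \<open>c10\<close> and
    \<open>twist\<close> remove all but this one.\<close>
  have c01: "cyclic_zero br0 br1"
    unfolding cyclic_zero_def
    using eqs(2) by (simp add: twist cyclic_zeroD[OF c10])
  have c11: "cyclic_zero br1 br1"
    using cyclic_zero_comp[OF addM c01] by (simp flip: br1_eq)
  show ?thesis
    using jacobi_deformed_bracket[OF b c00 c01 c10 c11]
      lie_algebra_add_scale[OF br0(1) br1(1) br0(2) br1(2) c00 c01 c10 c11] by blast
qed

end
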